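(* Let $V,\Lambda,K,\mu_s,\mu_o,w_s>0$ and $\bar K=\frac{2\Lambda^2\sqrt{V\Lambda+1}}{\mu_o^2(\sqrt{V\Lambda+1}-1)^3}$. In the single-service model, the optimal number $k_s^S$ of employees (when only the standard service is offered, System S), respectively the optimal number $k_o^O$ of contractors (when only the on-demand service is offered, System O), satisfies $$k_s^S=\frac{\lambda_s^S}{\mu_s}+\sqrt{\frac{\lambda_s^S}{\mu_sw_s}},\qquad\text{respectively}\qquad k_o^O=\frac{\lambda_o^O}{\mu_o}+\sqrt{\frac{\lambda_o^O}{\mu_o\cdot\frac{w_o^O\lambda_o^O}{k_o^O}\cdot\max\left\{\frac{2\bar K}{K},2\right\}}},$$ where $\lambda_s^S,\lambda_o^O$ are the optimal effective arrival rates, $w_o^O$ is the optimal per-service wage, and $\frac{w_o^O\lambda_o^O}{k_o^O}$ is the hourly wage per contractor.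
   Context: Customers arrive at rate $\Lambda$, have types $\theta$ uniform on $[0,1]$, and join service $i$ iff $U_i=V-p_i-\theta W_i\ge0$ ($p_i$ price, $W_i$ lead time). System S (standard service only): the service provider (SP) chooses price $p_s$ and number $k_s\ge0$ of employees (service rate $\mu_s$, hourly wage $w_s$); $\lambda_s=\Lambda\Pr(U_s\ge0)$, $W_s=1/(k_s\mu_s-\lambda_s)$ with $k_s\mu_s>\lambda_s$; the SP maximizes $p_s\lambda_s-w_sk_s$. The SP may shut down, with $k_s=\lambda_s=0$ and profit $0$. When $V=\frac{w_s}{\mu_s}+2\sqrt{\frac{w_s}{\Lambda\mu_s}}$, where the optimum is not unique, the optimal solution with $\lambda_s^S=\Lambda$ is taken. System O (on-demand service only): the SP chooses price $p_o$ and per-service wage $w_o$; there is a pool of $K$ contractors (service rate $\mu_o$) with reservation rates $r$ uniform on $[0,1]$, and $\lambda_o=\Lambda\Pr(U_o\ge0)$, $W_o=1/(k_o\mu_o-\lambda_o)$ with $k_o\mu_o>\lambda_o$, and the number $k_o$ of participating contractors satisfies $k_o=K\Pr(\lambda_ow_o/k_o\ge r)$, where the uniform distribution function is taken to be $x\mapsto x$, i.e. $k_o^2=K\lambda_ow_o$; the SP maximizes $p_o\lambda_o-\lambda_ow_o$. *)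

theory Defs
  imports "HOL-Probability.Probability"
begin

text \<open>
  Customers have type \<open>\<theta>\<close> uniform on \<open>[0,1]\<close> and join iff their utility is nonnegative.
  Staffing levels (numbers of employees or contractors) are real-valued.
\<close>

definition utility :: "real \<Rightarrow> real \<Rightarrow> real \<Rightarrow> real \<Rightarrow> real" where
  "utility V p W \<theta> = V - p - \<theta> * W"

definition joining_prob :: "real \<Rightarrow> real \<Rightarrow> real \<Rightarrow> real" where
  "joining_prob V p W =
     \<P>(\<theta> in uniform_measure lborel {0..1::real}. utility V p W \<theta> \<ge> 0)"

definition lead_time :: "real \<Rightarrow> real \<Rightarrow> real \<Rightarrow> real" where
  "lead_time \<mu> k lam = 1 / (k * \<mu> - lam)"

text \<open>
  The effective arrival rate is defined only implicitly, since the lead time depends on it;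
  the predicate below says that \<open>lam\<close> is an effective arrival rate for price \<open>p\<close> and staffing \<open>k\<close>
  (with \<open>\<Lambda>\<close> the total arrival rate and \<open>\<mu>\<close> the service rate per server).
\<close>

definition effective_rate ::
    "real \<Rightarrow> real \<Rightarrow> real \<Rightarrow> real \<Rightarrow> real \<Rightarrow> real \<Rightarrow> bool" where
  "effective_rate V \<Lambda> \<mu> p k lam \<longleftrightarrow>
     k * \<mu> > lam \<and> lam = \<Lambda> * joining_prob V p (lead_time \<mu> k lam)"


subsection \<open>System S: standard service only\<close>

text \<open>The first disjunct is the shut-down option, for which no lead time is defined.\<close>

definition S_feasible ::
    "real \<Rightarrow> real \<Rightarrow> real \<Rightarrow> real \<Rightarrow> real \<Rightarrow> real \<Rightarrow> bool" where
  "S_feasible V \<Lambda> \<mu>\<^sub>s p k lam \<longleftrightarrow>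
     (k = 0 \<and> lam = 0) \<or> (k \<ge> 0 \<and> effective_rate V \<Lambda> \<mu>\<^sub>s p k lam)"

definition S_profit :: "real \<Rightarrow> real \<Rightarrow> real \<Rightarrow> real \<Rightarrow> real" where
  "S_profit w\<^sub>s p k lam = p * lam - w\<^sub>s * k"

definition S_maximizer ::
    "real \<Rightarrow> real \<Rightarrow> real \<Rightarrow> real \<Rightarrow> real \<Rightarrow> real \<Rightarrow> real \<Rightarrow> bool" where
  "S_maximizer V \<Lambda> \<mu>\<^sub>s w\<^sub>s p k lam \<longleftrightarrow>
     S_feasible V \<Lambda> \<mu>\<^sub>s p k lam \<and>
     (\<forall>p' k' lam'. S_feasible V \<Lambda> \<mu>\<^sub>s p' k' lam' \<longrightarrow>
        S_profit w\<^sub>s p' k' lam' \<le> S_profit w\<^sub>s p k lam)"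

text \<open>
  At the critical valuation every arrival rate in \<open>[0,\<Lambda>]\<close> is optimal; ties are broken in
  favour of full service.
\<close>

definition S_optimal ::
    "real \<Rightarrow> real \<Rightarrow> real \<Rightarrow> real \<Rightarrow> real \<Rightarrow> real \<Rightarrow> real \<Rightarrow> bool" where
  "S_optimal V \<Lambda> \<mu>\<^sub>s w\<^sub>s p k lam \<longleftrightarrow>
     S_maximizer V \<Lambda> \<mu>\<^sub>s w\<^sub>s p k lam \<and>
     (V = w\<^sub>s / \<mu>\<^sub>s + 2 * sqrt (w\<^sub>s / (\<Lambda> * \<mu>\<^sub>s)) \<longrightarrow> lam = \<Lambda>)"


subsection \<open>System O: on-demand service only\<close>

text \<open>
  Distribution function of the contractors' reservation rates. It is deliberately not truncated
  to \<open>[0,1]\<close>: the model uses \<open>x \<mapsto> x\<close> throughout.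
\<close>

definition reservation_cdf :: "real \<Rightarrow> real" where
  "reservation_cdf x = x"

text \<open>
  The stability condition in \<open>effective_rate\<close> forces \<open>k > 0\<close>, so the division by \<open>k\<close> is proper,
  participation means \<open>k\<^sup>2 = K lam w\<close>, and \<open>lam\<close> and \<open>w\<close> are positive.
\<close>

definition O_feasible ::
    "real \<Rightarrow> real \<Rightarrow> real \<Rightarrow> real \<Rightarrow> real \<Rightarrow> real \<Rightarrow> real \<Rightarrow> real \<Rightarrow> bool" where
  "O_feasible V \<Lambda> K \<mu>\<^sub>o p w k lam \<longleftrightarrow>
     effective_rate V \<Lambda> \<mu>\<^sub>o p k lam \<and> k = K * reservation_cdf (lam * w / k)"

definition O_profit :: "real \<Rightarrow> real \<Rightarrow> real \<Rightarrow> real" where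
  "O_profit p w lam = p * lam - lam * w"

definition O_optimal ::
    "real \<Rightarrow> real \<Rightarrow> real \<Rightarrow> real \<Rightarrow> real \<Rightarrow> real \<Rightarrow> real \<Rightarrow> real \<Rightarrow> bool" where
  "O_optimal V \<Lambda> K \<mu>\<^sub>o p w k lam \<longleftrightarrow>
     O_feasible V \<Lambda> K \<mu>\<^sub>o p w k lam \<and>
     (\<forall>p' w' k' lam'. O_feasible V \<Lambda> K \<mu>\<^sub>o p' w' k' lam' \<longrightarrow>
        O_profit p' w' lam' \<le> O_profit p w lam)"

definition K_bar :: "real \<Rightarrow> real \<Rightarrow> real \<Rightarrow> real" where
  "K_bar V \<Lambda> \<mu>\<^sub>o =
     2 * \<Lambda>\<^sup>2 * sqrt (V * \<Lambda> + 1) / (\<mu>\<^sub>o\<^sup>2 * (sqrt (V * \<Lambda> + 1) - 1) ^ 3)"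

end

theory Submission
  imports Defs
begin

text \<open>
  A customer stream of rate \<open>lam\<close> served with excess capacity \<open>x = k \<mu> - lam\<close> yields at most the
  revenue \<open>V lam - lam\<^sup>2 / (\<Lambda> x)\<close>. Since \<open>lam\<^sup>2 / x = 2 r lam - r\<^sup>2 x + (lam - r x)\<^sup>2 / x\<close> for every
  \<open>r\<close>, this is an affine function of \<open>(lam, k)\<close> minus a square that vanishes iff \<open>lam = r x\<close>.
  In System S the choice \<open>r\<^sup>2 = w\<^sub>s \<Lambda> / \<mu>\<^sub>s\<close> makes the coefficient of \<open>x\<close> in the profit vanish,
  so the profit is linear in \<open>lam\<close> up to the square. In System O the remaining dependence on \<open>k\<close>
  is \<open>r\<^sup>2 \<mu>\<^sub>o k / \<Lambda> - k\<^sup>2 / K\<close>, another completed square; here \<open>r\<close> is chosen in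
  \<open>(0, sqrt (V \<Lambda> + 1) - 1]\<close> such that both squares vanish at \<open>lam = \<Lambda> min (K / K_bar) 1\<close>.
\<close>

section \<open>Effective arrival rates and the revenue bound\<close>

lemma joining_prob_eq:
  assumes "W > 0"
  shows "joining_prob V p W = max 0 (min 1 ((V - p) / W))"
proof -
  let ?c = "(V - p) / W"
  have iff: "utility V p W \<theta> \<ge> 0 \<longleftrightarrow> \<theta> \<le> ?c" for \<theta>
    using assms by (auto simp: utility_def field_simps)
  have int: "{0..1} \<inter> {\<theta>. \<theta> \<le> ?c} = {0..min 1 ?c}"
    by auto
  have "joining_prob V p W = measure (uniform_measure lborel {0..1}) {\<theta>. \<theta> \<le> ?c}"
    unfolding joining_prob_def iff by simp
  also have "\<dots> = measure lborel ({0..1} \<inter> {\<theta>. \<theta> \<le> ?c}) / measure lborel {0..1::real}"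
    by (rule measure_uniform_measure) auto
  also have "\<dots> = max 0 (min 1 ?c)"
    unfolding int by (simp add: content_real_if max_def)
  finally show ?thesis .
qed

lemma effective_rate_iff:
  "effective_rate V \<Lambda> \<mu> p k lam \<longleftrightarrow>
     k * \<mu> > lam \<and> lam = \<Lambda> * max 0 (min 1 ((V - p) * (k * \<mu> - lam)))"
  unfolding effective_rate_def lead_time_def by (auto simp: joining_prob_eq)

lemma effective_rate_bounds:
  assumes "effective_rate V \<Lambda> \<mu> p k lam" "\<Lambda> > 0"
  shows "0 \<le> lam" "lam \<le> \<Lambda>" "lam < k * \<mu>"
proof -
  from assms(1) have lam: "lam = \<Lambda> * max 0 (min 1 ((V - p) * (k * \<mu> - lam)))"
    and "lam < k * \<mu>"
    unfolding effective_rate_iff by auto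
  then show "lam < k * \<mu>" by simp
  show "0 \<le> lam" using assms(2) by (subst lam) simp
  show "lam \<le> \<Lambda>" using assms(2) by (subst lam) (simp add: mult_left_le)
qed

text \<open>For positive \<open>lam\<close> the truncation of the joining probability at 0 is
  inactive, so the fraction \<open>lam / \<Lambda>\<close> is at most
  \<open>(V - p) * (k * \<mu> - lam)\<close>, which bounds the price from above. Strictness is
  possible only when everybody joins.\<close>

lemma effective_rate_revenue_le:
  assumes eff: "effective_rate V \<Lambda> \<mu> p k lam" and "\<Lambda> > 0"
  shows "p * lam \<le> V * lam - lam\<^sup>2 / (\<Lambda> * (k * \<mu> - lam))"
proof (cases "lam = 0")
  case False
  let ?x = "k * \<mu> - lam"
  note b = effective_rate_bounds[OF eff \<open>\<Lambda> > 0\<close>]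
  have x: "?x > 0" and "lam > 0" using b False by auto
  have lam: "lam = \<Lambda> * max 0 (min 1 ((V - p) * ?x))"
    using eff unfolding effective_rate_iff by simp
  have "max 0 (min 1 ((V - p) * ?x)) > 0"
    using lam \<open>lam > 0\<close> \<open>\<Lambda> > 0\<close> by (metis zero_less_mult_pos)
  then have "max 0 (min 1 ((V - p) * ?x)) \<le> (V - p) * ?x"
    by (auto simp: max_def split: if_splits)
  then have "lam \<le> \<Lambda> * ((V - p) * ?x)"
    using \<open>\<Lambda> > 0\<close> by (subst lam) (rule mult_left_mono, auto)
  then have "lam / (\<Lambda> * ?x) \<le> V - p"
    using x \<open>\<Lambda> > 0\<close> by (simp add: pos_divide_le_eq mult_ac)
  then have "lam / (\<Lambda> * ?x) * lam \<le> (V - p) * lam"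
    using \<open>lam > 0\<close> by (intro mult_right_mono) auto
  then show ?thesis by (simp add: power2_eq_square algebra_simps)
qed simp

text \<open>This price makes the type \<open>lam / \<Lambda>\<close> indifferent, so the revenue
  bound is attained.\<close>

lemma effective_rate_price:
  assumes "\<Lambda> > 0" "0 < lam" "lam \<le> \<Lambda>" "lam < k * \<mu>"
  shows "effective_rate V \<Lambda> \<mu> (V - lam / (\<Lambda> * (k * \<mu> - lam))) k lam"
  using assms unfolding effective_rate_iff by (simp add: min_def max_def)

text \<open>The affine part is the tangent plane of \<open>y\<^sup>2 / x\<close> along the ray
  \<open>y = r * x\<close>. Keeping the remainder explicit lets later proofs read off the equality
  case.\<close>

lemma square_over_linear:
  fixes r x y :: real
  assumes "x \<noteq> 0"
  shows "y\<^sup>2 / x = 2 * r * y - r\<^sup>2 * x + (y - r * x)\<^sup>2 / x"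
  using assms by (simp add: field_simps power2_eq_square)

lemma effective_rate_revenue_le_affine:
  assumes eff: "effective_rate V \<Lambda> \<mu> p k lam" and "\<Lambda> > 0"
  shows "p * lam \<le> V * lam - (2 * r * lam - r\<^sup>2 * (k * \<mu> - lam)) / \<Lambda>
           - (lam - r * (k * \<mu> - lam))\<^sup>2 / (\<Lambda> * (k * \<mu> - lam))"
proof -
  have "lam\<^sup>2 / (k * \<mu> - lam) / \<Lambda> =
      (2 * r * lam - r\<^sup>2 * (k * \<mu> - lam) + (lam - r * (k * \<mu> - lam))\<^sup>2 / (k * \<mu> - lam)) / \<Lambda>"
    using effective_rate_bounds(3)[OF assms] by (subst square_over_linear[of _ _ r]) auto
  then show ?thesis
    using effective_rate_revenue_le[OF assms] by (simp add: add_divide_distrib mult.commute)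
qed


subsection \<open>System S\<close>

text \<open>\<open>A\<close> is the surplus of \<open>V\<close> over the critical valuation: its
  sign decides between full service and shutting down.\<close>

context
  fixes V \<Lambda> \<mu> c r A :: real
  assumes pos: "\<Lambda> > 0" "\<mu> > 0" "c > 0"
  defines "r \<equiv> sqrt (c * \<Lambda> / \<mu>)"
    and "A \<equiv> V - (c / \<mu> + 2 * sqrt (c / (\<Lambda> * \<mu>)))"
begin

lemma r_pos: "r > 0"
  using pos by (simp add: r_def)

lemma r_sq: "r\<^sup>2 = c * \<Lambda> / \<mu>"
  using pos by (simp add: r_def)

lemma A_eq: "A = V - c / \<mu> - 2 * r / \<Lambda>"
proof -
  have "c / (\<Lambda> * \<mu>) = (r / \<Lambda>)\<^sup>2"
    using pos r_sq by (simp add: power_divide power2_eq_square field_simps)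
  then have "sqrt (c / (\<Lambda> * \<mu>)) = r / \<Lambda>"
    using pos r_pos by (simp add: real_sqrt_unique)
  then show ?thesis by (simp add: A_def)
qed

lemma S_profit_le:
  assumes "effective_rate V \<Lambda> \<mu> p k lam"
  shows "S_profit c p k lam
    \<le> lam * A - (lam - r * (k * \<mu> - lam))\<^sup>2 / (\<Lambda> * (k * \<mu> - lam))"
proof -
  have "(2 * r * lam - r\<^sup>2 * (k * \<mu> - lam)) / \<Lambda> = 2 * r / \<Lambda> * lam - c * k + c / \<mu> * lam"
    using pos unfolding r_sq by (simp add: field_simps)
  then show ?thesis
    using effective_rate_revenue_le_affine[OF assms pos(1), of r]
    unfolding S_profit_def A_eq by (simp add: algebra_simps)
qed

lemma S_full_service:
  obtains p k where "S_feasible V \<Lambda> \<mu> p k \<Lambda>" "S_profit c p k \<Lambda> = \<Lambda> * A"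
proof -
  \<comment> \<open>Excess capacity \<open>\<Lambda> / r\<close> makes the square vanish at
    \<open>lam = \<Lambda>\<close>.\<close>
  define k where "k = (\<Lambda> + \<Lambda> / r) / \<mu>"
  define p where "p = V - \<Lambda> / (\<Lambda> * (k * \<mu> - \<Lambda>))"
  have k: "k * \<mu> - \<Lambda> = \<Lambda> / r" using pos by (simp add: k_def)
  moreover have "\<Lambda> / r > 0" using pos r_pos by simp
  ultimately have "\<Lambda> < k * \<mu>" by linarith
  then have "effective_rate V \<Lambda> \<mu> p k \<Lambda>"
    unfolding p_def using pos by (intro effective_rate_price) auto
  moreover have "k \<ge> 0" using pos r_pos by (simp add: k_def)
  moreover have "S_profit c p k \<Lambda> = \<Lambda> * A"
  proof -
    have "c * k = c / \<mu> * \<Lambda> + (c * \<Lambda> / \<mu>) / r"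
      using pos r_pos by (simp add: k_def field_simps)
    also have "\<dots> = c / \<mu> * \<Lambda> + r"
      using r_pos unfolding r_sq[symmetric] by (simp add: power2_eq_square)
    finally have ck: "c * k = c / \<mu> * \<Lambda> + r" .
    have "p * \<Lambda> = V * \<Lambda> - r"
      unfolding p_def k using pos r_pos by (simp add: field_simps)
    with ck show ?thesis
      using pos by (simp add: S_profit_def A_eq algebra_simps)
  qed
  ultimately show thesis using that by (auto simp: S_feasible_def)
qed

lemma S_profit_upper:
  assumes "S_feasible V \<Lambda> \<mu> p k lam"
  shows "S_profit c p k lam \<le> lam * A" "0 \<le> lam" "lam \<le> \<Lambda>"
proof -
  from assms consider "k = 0" "lam = 0" | "effective_rate V \<Lambda> \<mu> p k lam"
    by (auto simp: S_feasible_def)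
  then have "S_profit c p k lam \<le> lam * A \<and> 0 \<le> lam \<and> lam \<le> \<Lambda>"
  proof cases
    case 2
    note b = effective_rate_bounds[OF 2 pos(1)]
    have "(lam - r * (k * \<mu> - lam))\<^sup>2 / (\<Lambda> * (k * \<mu> - lam)) \<ge> 0"
      using b pos by simp
    with S_profit_le[OF 2] b show ?thesis by linarith
  qed (use pos in \<open>simp add: S_profit_def\<close>)
  then show "S_profit c p k lam \<le> lam * A" "0 \<le> lam" "lam \<le> \<Lambda>" by auto
qed

lemma S_optimal_exists: "\<exists>p k lam. S_optimal V \<Lambda> \<mu> c p k lam"
proof (cases "A \<ge> 0")
  case True
  obtain p k where pk: "S_feasible V \<Lambda> \<mu> p k \<Lambda>" "S_profit c p k \<Lambda> = \<Lambda> * A"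
    by (rule S_full_service)
  have "S_profit c p' k' lam' \<le> \<Lambda> * A" if "S_feasible V \<Lambda> \<mu> p' k' lam'" for p' k' lam'
    using S_profit_upper[OF that] mult_right_mono[of lam' \<Lambda> A] True by linarith
  with pk have "S_optimal V \<Lambda> \<mu> c p k \<Lambda>"
    unfolding S_optimal_def S_maximizer_def by auto
  then show ?thesis by blast
next
  case False
  have "S_profit c p' k' lam' \<le> 0" if "S_feasible V \<Lambda> \<mu> p' k' lam'" for p' k' lam'
    using S_profit_upper[OF that] mult_nonneg_nonpos[of lam' A] False by linarith
  \<comment> \<open>The premise of the tie-breaking rule is \<open>A = 0\<close>, so the rule holds
    vacuously here.\<close>
  moreover have "V \<noteq> c / \<mu> + 2 * sqrt (c / (\<Lambda> * \<mu>))"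
    using False by (simp add: A_def)
  ultimately have "S_optimal V \<Lambda> \<mu> c 0 0 0"
    unfolding S_optimal_def S_maximizer_def by (auto simp: S_feasible_def S_profit_def)
  then show ?thesis by blast
qed

text \<open>An optimum does at least as well as full service and shutting down, while
  \<open>lam * A\<close> never exceeds the better of the two; hence the square vanishes. With
  positive demand \<open>A\<close> cannot be negative, and \<open>A > 0\<close> or the tie-breaking
  rule gives \<open>lam = \<Lambda>\<close>.\<close>

lemma S_optimal_staffing:
  assumes "S_optimal V \<Lambda> \<mu> c p k lam"
  shows "k = lam / \<mu> + sqrt (lam / (\<mu> * c))"
proof -
  from assms have feas: "S_feasible V \<Lambda> \<mu> p k lam"
    and max: "\<And>p' k' lam'. S_feasible V \<Lambda> \<mu> p' k' lam' \<Longrightarrow>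
      S_profit c p' k' lam' \<le> S_profit c p k lam"
    and tie: "A = 0 \<Longrightarrow> lam = \<Lambda>"
    unfolding S_optimal_def S_maximizer_def A_def by auto
  from feas consider "k = 0" "lam = 0" | "effective_rate V \<Lambda> \<mu> p k lam"
    by (auto simp: S_feasible_def)
  then show ?thesis
  proof cases
    case 2
    let ?x = "k * \<mu> - lam"
    let ?q = "(lam - r * ?x)\<^sup>2 / (\<Lambda> * ?x)"
    note b = effective_rate_bounds[OF 2 pos(1)]
    have "\<Lambda> * A \<le> S_profit c p k lam"
      using S_full_service max by metis
    moreover have "0 \<le> S_profit c p k lam"
      using max[of 0 0 0] by (simp add: S_feasible_def S_profit_def)
    moreover note S_profit_le[OF 2]
    ultimately have ge: "\<Lambda> * A \<le> lam * A - ?q" "0 \<le> lam * A - ?q" by linarith+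
    have q: "?q \<ge> 0" using b pos by simp
    have "lam * A \<le> max 0 (\<Lambda> * A)"
      using b mult_right_mono[of lam \<Lambda> A] mult_nonneg_nonpos[of lam A] by linarith
    with ge q have "?q = 0" by linarith
    then have lam: "lam = r * ?x" using b pos by simp
    then have "lam > 0" using b r_pos by (metis diff_gt_0_iff_gt mult_pos_pos)
    have "A \<ge> 0" using ge(2) q \<open>lam > 0\<close> by (smt (verit) mult_pos_neg)
    then have full: "lam = \<Lambda>"
    proof (cases "A = 0")
      case False
      then have "A > 0" using \<open>A \<ge> 0\<close> by simp
      moreover have "\<Lambda> * A \<le> lam * A" using ge(1) q by linarith
      ultimately show ?thesis using b by simp
    qed (use tie in simp)
    \<comment> \<open>Full service is essential: \<open>r\<^sup>2\<close> contains
      \<open>\<Lambda>\<close>, the left side contains \<open>lam\<close>.\<close>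
    have "lam / (\<mu> * c) = (lam / (r * \<mu>))\<^sup>2"
      using pos unfolding power_divide power_mult_distrib r_sq full
      by (simp add: field_simps power2_eq_square)
    then have "sqrt (lam / (\<mu> * c)) = lam / (r * \<mu>)"
      using \<open>lam > 0\<close> r_pos pos by (simp add: real_sqrt_unique)
    also have "\<dots> = ?x / \<mu>"
      using lam r_pos pos by (simp add: field_simps)
    finally show ?thesis using pos by (simp add: field_simps)
  qed simp
qed

end


subsection \<open>System O\<close>

text \<open>Solving participation for the wage bill turns the profit into revenue minus
  \<open>k\<^sup>2 / K\<close>, eliminating \<open>w\<close>.\<close>

lemma O_feasible_iff:
  assumes "\<Lambda> > 0" "\<mu> > 0" "K > 0"
  shows "O_feasible V \<Lambda> K \<mu> p w k lam \<longleftrightarrow>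
    effective_rate V \<Lambda> \<mu> p k lam \<and> lam > 0 \<and> lam * w = k\<^sup>2 / K"
proof -
  have *: "k > 0" "k = K * (lam * w / k) \<longleftrightarrow> lam * w = k\<^sup>2 / K" "lam * w = k\<^sup>2 / K \<Longrightarrow> lam > 0"
    if eff: "effective_rate V \<Lambda> \<mu> p k lam"
  proof -
    note b = effective_rate_bounds[OF eff assms(1)]
    show k: "k > 0" using b assms(2) by (smt (verit) zero_less_mult_pos2)
    show "k = K * (lam * w / k) \<longleftrightarrow> lam * w = k\<^sup>2 / K"
      using k assms by (auto simp: field_simps power2_eq_square)
    show "lam > 0" if "lam * w = k\<^sup>2 / K"
      using that b(1) k assms(3) by (cases "lam = 0") auto
  qed
  then show ?thesis
    unfolding O_feasible_def reservation_cdf_def by blast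
qed

text \<open>
  \<open>(L, k\<^sub>0)\<close> will be the optimal arrival rate and staffing level; the factor
  \<open>V \<Lambda> - 2 r - r\<^sup>2\<close> is the multiplier of the constraint \<open>lam \<le> \<Lambda>\<close>, so either it vanishes or
  the constraint is tight.
\<close>

context
  fixes V \<Lambda> K \<mu> r L k\<^sub>0 :: real
  assumes pos: "\<Lambda> > 0" "K > 0" "\<mu> > 0" "r > 0"
    and L: "L * (2 * \<Lambda> * (1 + r)) = K * r ^ 3 * \<mu>\<^sup>2"
    and k\<^sub>0: "k\<^sub>0 = K * r\<^sup>2 * \<mu> / (2 * \<Lambda>)"
    and L_le: "L \<le> \<Lambda>"
    and mult: "2 * r + r\<^sup>2 \<le> V * \<Lambda>"
    and slack: "2 * r + r\<^sup>2 = V * \<Lambda> \<or> L = \<Lambda>"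
begin

lemma L_pos: "L > 0"
proof -
  have "L * (2 * \<Lambda> * (1 + r)) > 0" unfolding L using pos by simp
  then show ?thesis by (rule zero_less_mult_pos2) (use pos in simp)
qed

lemma k\<^sub>0_pos: "k\<^sub>0 > 0"
  using pos by (simp add: k\<^sub>0)

text \<open>The equation assumed for \<open>L\<close> encodes exactly this: at
  \<open>k\<^sub>0\<close>, the maximizer of
  \<open>r\<^sup>2 * \<mu> * k / \<Lambda> - k\<^sup>2 / K\<close>, the other square vanishes as
  well.\<close>

lemma excess: "L = r * (k\<^sub>0 * \<mu> - L)"
proof -
  have "L * (1 + r) = r * (k\<^sub>0 * \<mu>)"
    using L pos by (simp add: k\<^sub>0 field_simps power2_eq_square power3_eq_cube)
  then show ?thesis by (simp add: algebra_simps)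
qed

lemma O_profit_le:
  assumes "O_feasible V \<Lambda> K \<mu> p w k lam"
  shows "O_profit p w lam \<le> L * (V - (2 * r + r\<^sup>2) / \<Lambda>) + k\<^sub>0\<^sup>2 / K
    - (k - k\<^sub>0)\<^sup>2 / K - (lam - r * (k * \<mu> - lam))\<^sup>2 / (\<Lambda> * (k * \<mu> - lam))"
proof -
  from assms have eff: "effective_rate V \<Lambda> \<mu> p k lam" and w: "lam * w = k\<^sup>2 / K"
    using pos by (auto simp: O_feasible_iff)
  let ?q = "(lam - r * (k * \<mu> - lam))\<^sup>2 / (\<Lambda> * (k * \<mu> - lam))"
  have "O_profit p w lam \<le> V * lam - (2 * r * lam - r\<^sup>2 * (k * \<mu> - lam)) / \<Lambda> - k\<^sup>2 / K - ?q"
    using effective_rate_revenue_le_affine[OF eff pos(1), of r] w by (simp add: O_profit_def)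
  also have "V * lam - (2 * r * lam - r\<^sup>2 * (k * \<mu> - lam)) / \<Lambda> - k\<^sup>2 / K
    = lam * (V - (2 * r + r\<^sup>2) / \<Lambda>) + k\<^sub>0\<^sup>2 / K - (k - k\<^sub>0)\<^sup>2 / K"
    using pos by (simp add: k\<^sub>0 field_simps power2_eq_square)
  \<comment> \<open>Complementary slackness: the coefficient is zero, or it is nonnegative and
    \<open>L = \<Lambda>\<close>.\<close>
  also have "lam * (V - (2 * r + r\<^sup>2) / \<Lambda>) \<le> L * (V - (2 * r + r\<^sup>2) / \<Lambda>)"
    using slack
  proof
    assume "L = \<Lambda>"
    moreover have "V - (2 * r + r\<^sup>2) / \<Lambda> \<ge> 0" using mult pos by (simp add: field_simps)
    ultimately show ?thesis
      using effective_rate_bounds(2)[OF eff pos(1)] by (simp add: mult_right_mono)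
  qed (use pos in simp)
  finally show ?thesis by simp
qed

lemma O_attained:
  obtains p w where "O_feasible V \<Lambda> K \<mu> p w k\<^sub>0 L"
    "O_profit p w L = L * (V - (2 * r + r\<^sup>2) / \<Lambda>) + k\<^sub>0\<^sup>2 / K"
proof -
  define p where "p = V - L / (\<Lambda> * (k\<^sub>0 * \<mu> - L))"
  define w where "w = k\<^sub>0\<^sup>2 / (K * L)"
  have x: "k\<^sub>0 * \<mu> - L > 0" using excess L_pos pos(4) by (metis zero_less_mult_pos)
  then have "effective_rate V \<Lambda> \<mu> p k\<^sub>0 L"
    unfolding p_def using pos L_pos L_le by (intro effective_rate_price) auto
  moreover have w: "L * w = k\<^sub>0\<^sup>2 / K" using L_pos by (simp add: w_def)
  ultimately have "O_feasible V \<Lambda> K \<mu> p w k\<^sub>0 L"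
    using pos L_pos by (simp add: O_feasible_iff)
  moreover have "O_profit p w L = L * (V - (2 * r + r\<^sup>2) / \<Lambda>) + k\<^sub>0\<^sup>2 / K"
  proof -
    have "L / (\<Lambda> * (k\<^sub>0 * \<mu> - L)) = r / \<Lambda>"
      by (subst (1) excess) (use x pos in simp)
    then have "p * L = V * L - r / \<Lambda> * L"
      by (simp add: p_def left_diff_distrib)
    \<comment> \<open>The claimed value adds \<open>k\<^sub>0\<^sup>2 / K\<close> whereas the wage
      bill subtracts it; the doubled term accounts for the difference.\<close>
    moreover have "k\<^sub>0\<^sup>2 / K + k\<^sub>0\<^sup>2 / K = r * (r * (k\<^sub>0 * \<mu>)) / \<Lambda>"
      using pos by (simp add: k\<^sub>0 field_simps power2_eq_square)
    moreover have "r * (k\<^sub>0 * \<mu>) = L * (1 + r)"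
      using excess by (simp add: algebra_simps)
    moreover have "L * (V - (2 * r + r\<^sup>2) / \<Lambda>) = V * L - r / \<Lambda> * L - r * (L * (1 + r)) / \<Lambda>"
      using pos by (simp add: field_simps power2_eq_square)
    ultimately show ?thesis
      using w by (simp add: O_profit_def mult.commute)
  qed
  ultimately show thesis using that by blast
qed

lemma O_optimal_unique:
  shows "\<exists>p w. O_optimal V \<Lambda> K \<mu> p w k\<^sub>0 L"
    and "O_optimal V \<Lambda> K \<mu> p w k lam \<Longrightarrow> k = k\<^sub>0 \<and> lam = L"
proof -
  let ?M = "L * (V - (2 * r + r\<^sup>2) / \<Lambda>) + k\<^sub>0\<^sup>2 / K"
  obtain p0 w0 where pw: "O_feasible V \<Lambda> K \<mu> p0 w0 k\<^sub>0 L" "O_profit p0 w0 L = ?M"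
    by (rule O_attained)
  have nonneg: "(k' - k\<^sub>0)\<^sup>2 / K \<ge> 0"
    "(lam' - r * (k' * \<mu> - lam'))\<^sup>2 / (\<Lambda> * (k' * \<mu> - lam')) \<ge> 0"
    if "O_feasible V \<Lambda> K \<mu> p' w' k' lam'" for p' w' k' lam'
    using that pos effective_rate_bounds(3)[of V \<Lambda> \<mu> p' k' lam']
    by (auto simp: O_feasible_iff)
  have "O_profit p' w' lam' \<le> ?M" if "O_feasible V \<Lambda> K \<mu> p' w' k' lam'" for p' w' k' lam'
    using O_profit_le[OF that] nonneg[OF that] by linarith
  with pw have "O_optimal V \<Lambda> K \<mu> p0 w0 k\<^sub>0 L"
    unfolding O_optimal_def by simp
  then show "\<exists>p w. O_optimal V \<Lambda> K \<mu> p w k\<^sub>0 L" by blast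
  assume "O_optimal V \<Lambda> K \<mu> p w k lam"
  then have feas: "O_feasible V \<Lambda> K \<mu> p w k lam" and "?M \<le> O_profit p w lam"
    using pw unfolding O_optimal_def by metis+
  with O_profit_le[OF feas] nonneg[OF feas]
  have "(k - k\<^sub>0)\<^sup>2 / K = 0" "(lam - r * (k * \<mu> - lam))\<^sup>2 / (\<Lambda> * (k * \<mu> - lam)) = 0"
    by linarith+
  moreover have "lam < k * \<mu>"
    using feas pos effective_rate_bounds(3) by (auto simp: O_feasible_iff)
  ultimately have "k = k\<^sub>0" and lam: "lam = r * (k * \<mu> - lam)"
    using pos by auto
  have "lam * (1 + r) = L * (1 + r)"
    using lam excess unfolding \<open>k = k\<^sub>0\<close> by (simp add: algebra_simps)
  with \<open>k = k\<^sub>0\<close> pos show "k = k\<^sub>0 \<and> lam = L" by simp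
qed

text \<open>The hourly wage equals \<open>k\<^sub>0 / K\<close>, that is
  \<open>r\<^sup>2 * \<mu> / (2 * \<Lambda>)\<close>. The factor \<open>m\<close> replaces
  \<open>2 * \<Lambda>\<close> by \<open>L\<close> in the denominator, which makes the radicand a
  perfect square.\<close>

lemma O_optimal_staffing:
  assumes opt: "O_optimal V \<Lambda> K \<mu> p w k lam" and m: "L * m = 2 * \<Lambda>"
  shows "k = lam / \<mu> + sqrt (lam / (\<mu> * (w * lam / k) * m))"
proof -
  have k: "k = k\<^sub>0" and lam: "lam = L"
    using O_optimal_unique(2)[OF opt] by auto
  have "L * w = k\<^sub>0\<^sup>2 / K"
    using opt pos unfolding O_optimal_def k lam by (simp add: O_feasible_iff)
  then have "w * L / k\<^sub>0 = k\<^sub>0 / K"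
    using k\<^sub>0_pos by (simp add: mult.commute power2_eq_square)
  then have wage: "w * L / k\<^sub>0 = r\<^sup>2 * \<mu> / (2 * \<Lambda>)"
    using pos by (simp add: k\<^sub>0)
  have m': "m = 2 * \<Lambda> / L" using m L_pos by (simp add: field_simps)
  have "L / (\<mu> * (w * L / k\<^sub>0) * m) = (L / (r * \<mu>))\<^sup>2"
    unfolding wage m' using pos L_pos by (simp add: field_simps power2_eq_square)
  then have "sqrt (L / (\<mu> * (w * L / k\<^sub>0) * m)) = L / (r * \<mu>)"
    using L_pos pos by (simp add: real_sqrt_unique)
  also have "\<dots> = (k\<^sub>0 * \<mu> - L) / \<mu>"
    using excess pos by (simp add: field_simps)
  finally show ?thesis
    unfolding k lam using pos by (simp add: field_simps)
qed

end

section \<open>Choosing \<open>r\<close> in System O\<close>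

lemma K_bar_pos:
  assumes "V > 0" "\<Lambda> > 0" "\<mu> > 0"
  shows "K_bar V \<Lambda> \<mu> > 0"
  using assms by (simp add: K_bar_def add_pos_pos)

text \<open>The intermediate value theorem yields \<open>r\<close> in \<open>[0, s - 1]\<close> with
  \<open>f r = L\<close>, where \<open>s - 1\<close> is the positive root of
  \<open>2 * r + r\<^sup>2 = V * \<Lambda>\<close>. Strict growth of \<open>f\<close> gives
  slackness: \<open>r < s - 1\<close> forces \<open>L = \<Lambda>\<close>.\<close>

lemma O_multiplier_exists:
  assumes "V > 0" "\<Lambda> > 0" "K > 0" "\<mu> > 0"
  defines "L \<equiv> \<Lambda> * min (K / K_bar V \<Lambda> \<mu>) 1"
  obtains r where "r > 0" "L * (2 * \<Lambda> * (1 + r)) = K * r ^ 3 * \<mu>\<^sup>2"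
    "2 * r + r\<^sup>2 \<le> V * \<Lambda>" "2 * r + r\<^sup>2 = V * \<Lambda> \<or> L = \<Lambda>"
proof -
  define s where "s = sqrt (V * \<Lambda> + 1)"
  \<comment> \<open>The arrival rate at which both squares vanish for a given
    \<open>r\<close>.\<close>
  define f where "f r = K * r ^ 3 * \<mu>\<^sup>2 / (2 * \<Lambda> * (1 + r))" for r
  have s: "s > 1" "s\<^sup>2 = V * \<Lambda> + 1"
    using assms(1,2) by (auto simp: s_def)
  have "L > 0"
    using assms(2,3) K_bar_pos[OF assms(1,2,4)] by (simp add: L_def)
  \<comment> \<open>Origin of \<open>K_bar\<close>: the pool size at which this rate reaches
    \<open>\<Lambda>\<close>.\<close>
  have fs: "f (s - 1) = \<Lambda> * (K / K_bar V \<Lambda> \<mu>)"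
    using assms(2,4) s(1) unfolding f_def K_bar_def s_def[symmetric]
    by (simp add: field_simps power2_eq_square)
  have L: "L = min (f (s - 1)) \<Lambda>"
    unfolding fs L_def using assms(2) by (simp add: min_mult_distrib_left)
  have "\<exists>r\<ge>0. r \<le> s - 1 \<and> f r = L"
  proof (rule IVT')
    show "f 0 \<le> L" using \<open>L > 0\<close> by (simp add: f_def)
    show "L \<le> f (s - 1)" by (simp add: L)
    show "continuous_on {0..s - 1} f"
      unfolding f_def using assms(2) by (auto intro!: continuous_intros)
  qed (use s in simp)
  then obtain r where r: "r \<ge> 0" "r \<le> s - 1" "f r = L" by blast
  have "r \<noteq> 0" using r(3) \<open>L > 0\<close> by (auto simp: f_def)
  show thesis
  proof (rule that[of r])
    show "r > 0" using r(1) \<open>r \<noteq> 0\<close> by simp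
    show "L * (2 * \<Lambda> * (1 + r)) = K * r ^ 3 * \<mu>\<^sup>2"
      using r(1) assms(2) unfolding r(3)[symmetric] f_def by simp
    have "(r + 1)\<^sup>2 \<le> s\<^sup>2" using r by (intro power_mono) auto
    then show "2 * r + r\<^sup>2 \<le> V * \<Lambda>" unfolding s(2) by (simp add: power2_sum)
    show "2 * r + r\<^sup>2 = V * \<Lambda> \<or> L = \<Lambda>"
    proof (cases "r = s - 1")
      case True
      then have "(r + 1)\<^sup>2 = V * \<Lambda> + 1" using s(2) by simp
      then show ?thesis by (simp add: power2_sum)
    next
      case False
      have "f r < f (s - 1)"
      proof -
        have "r ^ 3 * (1 + (s - 1)) < (s - 1) ^ 3 * (1 + r)"
        proof -
          have "r\<^sup>2 < (s - 1)\<^sup>2" "r ^ 3 < (s - 1) ^ 3"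
            using r False by (auto intro!: power_strict_mono)
          moreover have "r ^ 3 * (s - 1) \<le> (s - 1) ^ 3 * r"
            using r(1,2) \<open>r\<^sup>2 < (s - 1)\<^sup>2\<close> mult_right_mono[of "r\<^sup>2" "(s - 1)\<^sup>2" "r * (s - 1)"]
            by (simp add: power2_eq_square power3_eq_cube mult_ac)
          ultimately show ?thesis by (simp add: algebra_simps)
        qed
        then have "r ^ 3 / (1 + r) < (s - 1) ^ 3 / (1 + (s - 1))"
          using r(1) s(1) by (simp add: divide_simps mult.commute)
        then have "K * \<mu>\<^sup>2 / (2 * \<Lambda>) * (r ^ 3 / (1 + r))
            < K * \<mu>\<^sup>2 / (2 * \<Lambda>) * ((s - 1) ^ 3 / (1 + (s - 1)))"
          using assms(2,3,4) by (intro mult_strict_left_mono) auto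
        then show ?thesis by (simp add: f_def mult_ac)
      qed
      then show ?thesis using r(3) L by (auto simp: min_def split: if_splits)
    qed
  qed
qed

theorem corollary1:
  fixes V \<Lambda> K \<mu>\<^sub>s \<mu>\<^sub>o w\<^sub>s :: real
  assumes "V > 0" and "\<Lambda> > 0" and "K > 0" and "\<mu>\<^sub>s > 0" and "\<mu>\<^sub>o > 0" and "w\<^sub>s > 0"
  shows
    "(\<exists>p k lam. S_optimal V \<Lambda> \<mu>\<^sub>s w\<^sub>s p k lam) \<and>
     (\<forall>p k lam. S_optimal V \<Lambda> \<mu>\<^sub>s w\<^sub>s p k lam \<longrightarrow>
        k = lam / \<mu>\<^sub>s + sqrt (lam / (\<mu>\<^sub>s * w\<^sub>s))) \<and>
     (\<exists>p w k lam. O_optimal V \<Lambda> K \<mu>\<^sub>o p w k lam) \<and>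
     (\<forall>p w k lam. O_optimal V \<Lambda> K \<mu>\<^sub>o p w k lam \<longrightarrow>
        k = lam / \<mu>\<^sub>o +
            sqrt (lam / (\<mu>\<^sub>o * (w * lam / k) * max (2 * K_bar V \<Lambda> \<mu>\<^sub>o / K) 2)))"
proof -
  let ?B = "K_bar V \<Lambda> \<mu>\<^sub>o"
  define L where "L = \<Lambda> * min (K / ?B) 1"
  define m where "m = max (2 * ?B / K) 2"
  have B: "?B > 0" using assms by (intro K_bar_pos)
  \<comment> \<open>\<open>m\<close> is twice the reciprocal of
    \<open>min (K / ?B) 1\<close>.\<close>
  have m: "L * m = 2 * \<Lambda>"
    using B assms by (simp add: L_def m_def min_def max_def field_simps)
  have L_le: "L \<le> \<Lambda>" using assms by (simp add: L_def mult_left_le)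
  obtain r where r: "r > 0" "L * (2 * \<Lambda> * (1 + r)) = K * r ^ 3 * \<mu>\<^sub>o\<^sup>2"
    "2 * r + r\<^sup>2 \<le> V * \<Lambda>" "2 * r + r\<^sup>2 = V * \<Lambda> \<or> L = \<Lambda>"
    using O_multiplier_exists[OF assms(1,2,3,5)] unfolding L_def by blast
  \<comment> \<open>\<open>refl\<close> discharges the equation for \<open>k\<^sub>0\<close> and
    thereby instantiates it.\<close>
  note O_params = assms(2,3,5) r(1,2) refl L_le r(3,4)
  show ?thesis
    unfolding m_def[symmetric]
    using S_optimal_exists[OF assms(2,4,6)] S_optimal_staffing[OF assms(2,4,6)]
      O_optimal_unique(1)[OF O_params] O_optimal_staffing[OF O_params _ m]
    by blast
qed

end
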